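(* Let $g_1,\ldots,g_m\in\mathbb{R}^p$, and let $\{1,\ldots,m\}$ be partitioned into a set $\mathcal{B}$ of byzantine indices with $|\mathcal{B}|=\alpha m$ and a set $\mathcal{M}$ of honest indices with $|\mathcal{M}|=(1-\alpha)m$, where $\alpha\le\frac12$; the vectors $g_i$ with $i\in\mathcal{B}$ are arbitrary. Let $\beta$ satisfy $\alpha\le\beta<1$ and let $G=\mathbf{Norm\_Screen}_\beta(g_1,\ldots,g_m)$. Then for every vector $S\in\mathbb{R}^p$, $$\|G-S\|\le\frac{2\alpha}{1-\beta}\|S\|+\max_{i\in\mathcal{M}}\|g_i-S\|.$$
   Context: $\|\cdot\|$ is the Euclidean ($L_2$) norm. Norm-based screening: given $m$ vectors $g_1,\ldots,g_m\in\mathbb{R}^p$ and a screening percentage $\beta\in[0,1)$, reorder the indices as $(1),\ldots,(m)$ so that $\|g_{(1)}\|\le\cdots\le\|g_{(m)}\|$ (ties broken arbitrarily), set $\mathcal{U}=\{(1),\ldots,((1-\beta)m)\}$ (the indices of the $(1-\beta)m$ inputs of smallest norm), and define $\mathbf{Norm\_Screen}_\beta(g_1,\ldots,g_m)=\frac{1}{|\mathcal{U}|}\sum_{i\in\mathcal{U}}g_i$. It is understood that $\alpha\ge 0$ and that $\alpha m$ and $(1-\beta)m$ are integers. *)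

theory Defs
  imports "HOL-Analysis.Finite_Cartesian_Product"
begin

text \<open>
  \<open>norm_ordering m g \<sigma>\<close> says that \<open>\<sigma> 1, \<dots>, \<sigma> m\<close> is a reordering of the indices
  along which the norms are nondecreasing. With ties there are several such \<open>\<sigma>\<close>; each of
  them is one way of breaking the ties, so \<open>\<sigma>\<close> is an explicit argument of the
  definitions below.
\<close>

definition norm_ordering :: "nat \<Rightarrow> (nat \<Rightarrow> real ^ 'p) \<Rightarrow> (nat \<Rightarrow> nat) \<Rightarrow> bool" where
  "norm_ordering m g \<sigma> \<longleftrightarrow>
     bij_betw \<sigma> {1..m} {1..m} \<and> mono_on {1..m} (\<lambda>j. norm (g (\<sigma> j)))"

text \<open>The floor is only a coercion: it is meant for \<open>\<beta>\<close> with \<open>(1 - \<beta>) * m\<close> an integer.\<close>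

definition screened_indices :: "real \<Rightarrow> nat \<Rightarrow> (nat \<Rightarrow> nat) \<Rightarrow> nat set" where
  "screened_indices \<beta> m \<sigma> = \<sigma> ` {1..nat \<lfloor>(1 - \<beta>) * real m\<rfloor>}"

definition Norm_Screen ::
    "real \<Rightarrow> nat \<Rightarrow> (nat \<Rightarrow> nat) \<Rightarrow> (nat \<Rightarrow> real ^ 'p) \<Rightarrow> real ^ 'p" where
  "Norm_Screen \<beta> m \<sigma> g =
     (1 / real (card (screened_indices \<beta> m \<sigma>))) *\<^sub>R (\<Sum>i\<in>screened_indices \<beta> m \<sigma>. g i)"

end

theory Submission
  imports Defs
begin

text \<open>
  A screened byzantine index \<open>i\<close> forces some honest index \<open>j\<close> to be screened out, because at most
  as many indices are kept as there are honest ones. Hence \<open>norm (g i) \<le> norm (g j)\<close>, which puts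
  \<open>g i\<close> within \<open>2 * norm S + max\<close> of \<open>S\<close>, where \<open>max\<close> is the largest honest deviation. At most
  \<open>\<alpha> * m\<close> of the \<open>(1 - \<beta>) * m\<close> averaged terms pay the extra \<open>2 * norm S\<close>.
\<close>

text \<open>The kept positions form an initial segment of the ordering, so the position of an
  unscreened index comes after that of a screened one. Arguing by positions covers every way of
  breaking ties.\<close>

lemma norm_screened_le_unscreened:
  assumes "norm_ordering m g \<sigma>"
    and i: "i \<in> screened_indices \<beta> m \<sigma>"
    and j: "j \<in> {1..m}" "j \<notin> screened_indices \<beta> m \<sigma>"
  shows "norm (g i) \<le> norm (g j)"
proof -
  let ?k = "nat \<lfloor>(1 - \<beta>) * real m\<rfloor>"
  have bij: "bij_betw \<sigma> {1..m} {1..m}" and mono: "mono_on {1..m} (\<lambda>l. norm (g (\<sigma> l)))"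
    using assms(1) by (auto simp: norm_ordering_def)
  obtain a where a: "a \<in> {1..?k}" "i = \<sigma> a"
    using i by (auto simp: screened_indices_def)
  obtain b where b: "b \<in> {1..m}" "j = \<sigma> b"
    using j(1) bij by (metis bij_betw_imp_surj_on imageE)
  have "b \<notin> {1..?k}"
    using j(2) b by (auto simp: screened_indices_def)
  then have "a \<le> b" "a \<in> {1..m}"
    using a b by auto
  then show ?thesis
    using mono_onD[OF mono _ b(1)] a b by auto
qed

text \<open>Integrality makes the floor exact, and \<open>0 \<le> \<beta>\<close> keeps the
  positions inside \<open>{1..m}\<close>, where injectivity of \<open>\<sigma>\<close> preserves
  their number.\<close>

lemma card_screened_indices:
  assumes "norm_ordering m g \<sigma>" "0 \<le> \<beta>" "\<beta> \<le> 1" "(1 - \<beta>) * real m \<in> \<int>"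
  shows "screened_indices \<beta> m \<sigma> \<subseteq> {1..m}"
    and "real (card (screened_indices \<beta> m \<sigma>)) = (1 - \<beta>) * real m"
proof -
  let ?k = "nat \<lfloor>(1 - \<beta>) * real m\<rfloor>"
  have bij: "bij_betw \<sigma> {1..m} {1..m}"
    using assms(1) by (simp add: norm_ordering_def)
  have nonneg: "0 \<le> (1 - \<beta>) * real m"
    using assms(3) by simp
  then have k: "real ?k = (1 - \<beta>) * real m"
    using assms(4) by (auto elim: Ints_cases)
  moreover have "(1 - \<beta>) * real m \<le> real m"
    using assms(2) by (simp add: mult_left_le_one_le assms(3))
  ultimately have sub: "{1..?k} \<subseteq> {1..m}"
    by auto
  then show "screened_indices \<beta> m \<sigma> \<subseteq> {1..m}"
    using bij by (auto simp: screened_indices_def bij_betw_def)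
  have "card (screened_indices \<beta> m \<sigma>) = ?k"
    using bij sub unfolding screened_indices_def
    by (metis bij_betw_imp_inj_on card_atLeastAtMost card_image diff_Suc_1 inj_on_subset One_nat_def)
  then show "real (card (screened_indices \<beta> m \<sigma>)) = (1 - \<beta>) * real m"
    using k by simp
qed

theorem theorem1:
  fixes g :: "nat \<Rightarrow> real ^ 'p"
    and m :: nat
    and \<alpha> \<beta> :: real
    and B M :: "nat set"
    and \<sigma> :: "nat \<Rightarrow> nat"
    and G S :: "real ^ 'p"
  assumes "m \<ge> 1"
    and "B \<union> M = {1..m}" and "B \<inter> M = {}"
    and "real (card B) = \<alpha> * real m"
    and "real (card M) = (1 - \<alpha>) * real m"
    and "0 \<le> \<alpha>" and "\<alpha> \<le> 1 / 2"
    and "\<alpha> \<le> \<beta>" and "\<beta> < 1"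
    and "(1 - \<beta>) * real m \<in> \<int>"
    and "norm_ordering m g \<sigma>"
    and "G = Norm_Screen \<beta> m \<sigma> g"
  shows "norm (G - S) \<le> 2 * \<alpha> / (1 - \<beta>) * norm S + (MAX i\<in>M. norm (g i - S))"
proof -
  define U where "U = screened_indices \<beta> m \<sigma>"
  \<comment> \<open>\<open>M\<close> is nonempty, as \<open>card M\<close> is at least
    \<open>m / 2 > 0\<close>, so this is a genuine maximum.\<close>
  define D where "D = (MAX i\<in>M. norm (g i - S))"
  have U_sub: "U \<subseteq> {1..m}" and card_U: "real (card U) = (1 - \<beta>) * real m"
    using card_screened_indices[OF assms(11) _ _ assms(10)] assms(6,8,9) by (auto simp: U_def)
  have U_pos: "0 < real (card U)"
    unfolding card_U using assms(1,9) by simp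
  have fin: "finite U" "finite M" "finite B"
    using finite_subset[OF U_sub] assms(2) by (simp, (metis finite_Un finite_atLeastAtMost)+)
  have le_D: "norm (g i - S) \<le> D" if "i \<in> M" for i
    using that fin(2) by (simp add: D_def)
  have byz: "norm (g i - S) \<le> D + 2 * norm S" if i: "i \<in> U" "i \<notin> M" for i
  proof -
    \<comment> \<open>This follows from \<open>\<alpha> \<le> \<beta>\<close>. If all of
      \<open>M\<close> were kept, the additional kept index \<open>i\<close> would make
      \<open>U\<close> strictly larger than \<open>M\<close>.\<close>
    have "real (card U) \<le> real (card M)"
      unfolding card_U assms(5) using assms(8) by (intro mult_right_mono) auto
    moreover have "card U > card M" if "M \<subseteq> U"
      using that i fin(1) by (intro psubset_card_mono) auto
    ultimately obtain j where j: "j \<in> M" "j \<notin> U"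
      by fastforce
    then have "norm (g i) \<le> norm (g j)"
      using norm_screened_le_unscreened[OF assms(11), of i \<beta> j] i assms(2)
      unfolding U_def by blast
    \<comment> \<open>One \<open>norm S\<close> is paid here to pass from \<open>g j\<close> to its
      deviation, the other below to pass from \<open>g i\<close> to \<open>g i - S\<close>.\<close>
    also have "\<dots> \<le> D + norm S"
      using le_D[OF j(1)] norm_triangle_sub[of "g j" S] by simp
    finally show ?thesis
      using norm_triangle_ineq4[of "g i" S] by simp
  qed
  have "(\<Sum>i\<in>U. norm (g i - S)) \<le> (\<Sum>i\<in>U. D + (if i \<in> B then 2 * norm S else 0))"
  proof (intro sum_mono)
    fix i assume "i \<in> U"
    then have "i \<in> M" if "i \<notin> B"
      using that U_sub assms(2) by blast
    then show "norm (g i - S) \<le> D + (if i \<in> B then 2 * norm S else 0)"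
      using le_D byz[OF \<open>i \<in> U\<close>] assms(3) by (cases "i \<in> B") auto
  qed
  also have "\<dots> = real (card U) * D + real (card (U \<inter> B)) * (2 * norm S)"
    using fin(1) by (simp add: sum.distrib sum.inter_restrict[symmetric])
  also have "\<dots> \<le> real (card U) * D + (\<alpha> * real m) * (2 * norm S)"
    unfolding assms(4)[symmetric] using fin(3)
    by (intro add_left_mono mult_right_mono) (auto intro: card_mono)
  finally have sum_le: "(\<Sum>i\<in>U. norm (g i - S)) \<le> \<dots>" .
  \<comment> \<open>As \<open>U\<close> is nonempty, \<open>S\<close> is the average of
    \<open>card U\<close> copies of itself.\<close>
  have "G - S = (1 / real (card U)) *\<^sub>R (\<Sum>i\<in>U. g i - S)"
    using U_pos
    by (simp add: assms(12) Norm_Screen_def U_def[symmetric] sum_subtractf scaleR_diff_right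
        sum_constant_scaleR del: sum_constant)
  then have "norm (G - S) \<le> (\<Sum>i\<in>U. norm (g i - S)) / real (card U)"
    using norm_sum[of "\<lambda>i. g i - S" U] by (simp add: divide_right_mono)
  also have "\<dots> \<le> (real (card U) * D + (\<alpha> * real m) * (2 * norm S)) / real (card U)"
    using sum_le by (intro divide_right_mono) auto
  \<comment> \<open>The factor \<open>m\<close> cancels, since \<open>card U\<close> is
    \<open>(1 - \<beta>) * m\<close>.\<close>
  also have "\<dots> = 2 * \<alpha> / (1 - \<beta>) * norm S + D"
    using assms(1,9) unfolding card_U by (simp add: field_simps)
  finally show ?thesis
    by (simp add: D_def)
qed

end
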